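(* Let $\mathbf{q}=(q_0,\dots,q_n)$ be positive integers, $q = \operatorname{lcm}(q_0,\dots,q_n)$, $n_i = q/q_i$, and $\phi : \mathbb{WP}^n_{\mathbf{q}}(\mathbb{Q})\to\mathbb{P}^n(\mathbb{Q})$, $\phi([x_0:\dots:x_n]) = [x_0^{n_0}:\dots:x_n^{n_n}]$. A point $y=[y_0:\dots:y_n]\in \mathbb{P}^n(\mathbb{Q})$ with all $y_i \neq 0$ admits a rational preimage under $\phi$ (a preimage in $\mathbb{WP}^n_{\mathbf{q}}(\mathbb{Q})$) if and only if the following two conditions hold: (i) for every prime $p$ and all pairs $i,j$, $v_p(y_i) \equiv v_p(y_j) \pmod{\gcd(n_i, n_j)}$; (ii) the coordinates $y_i$ for which $n_i$ is even all have the same sign. Equivalently, for a primitive integral representative $(y_0,\dots,y_n)$ of $y$, condition (i) states that the valuation vector $(v_p(y_0),\dots,v_p(y_n))$ lies in $$M_{\mathbf{q}} = \{ t \in \mathbb{Z}_{\geq 0}^{n+1} : \min_i t_i = 0,\ t_i \equiv t_j \!\!\pmod{\gcd(n_i,n_j)} \text{ for all } i,j \}$$ for every prime $p$. For points $y\in\mathbb{P}^n(\mathbb{Q})$ with vanishing coordinates the same criterion (i)–(ii) applies to the sub-tuple of nonzero coordinates (with the same exponents $n_i$).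
   Context: $\mathbb{WP}^n_{\mathbf{q}}(\overline{\mathbb{Q}})$ is the set of nonzero tuples $\mathbf{x} \in \overline{\mathbb{Q}}^{n+1}$ modulo $\mathbf{x} \sim (\lambda^{q_0}x_0, \dots, \lambda^{q_n}x_n)$, $\lambda \in \overline{\mathbb{Q}}^{\times}$; $\mathbb{WP}^n_{\mathbf{q}}(\mathbb{Q})$ is the subset of classes admitting a representative in $\mathbb{Q}^{n+1}$. $v_p$ is the $p$-adic valuation. A primitive integral representative is an integer tuple with $\gcd(y_0,\dots,y_n)=1$. *)

theory Defs
  imports "HOL-Algebra.Algebraic_Closure_Type" "HOL-Library.FuncSet" "HOL-Number_Theory.Cong"
begin

type_synonym qbar = "rat alg_closure"

section \<open>Weighted projective space over the algebraic closure of the rationals\<close>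

text \<open>Tuples \<open>(x\<^sub>0, \<dots>, x\<^sub>n)\<close> are functions on \<open>{..n}\<close>, extensional outside so that equality of
  functions is equality of tuples.\<close>

definition nonzero_tuples :: "nat \<Rightarrow> (nat \<Rightarrow> qbar) set" where
  "nonzero_tuples n = {x \<in> {..n} \<rightarrow>\<^sub>E UNIV. \<exists>i\<le>n. x i \<noteq> 0}"

definition wscale :: "nat \<Rightarrow> (nat \<Rightarrow> nat) \<Rightarrow> qbar \<Rightarrow> (nat \<Rightarrow> qbar) \<Rightarrow> nat \<Rightarrow> qbar" where
  "wscale n q l x = (\<lambda>i\<in>{..n}. l ^ q i * x i)"

definition wrel :: "nat \<Rightarrow> (nat \<Rightarrow> nat) \<Rightarrow> ((nat \<Rightarrow> qbar) \<times> (nat \<Rightarrow> qbar)) set" where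
  "wrel n q = {(x, y). x \<in> nonzero_tuples n \<and> y \<in> nonzero_tuples n \<and>
                       (\<exists>l. l \<noteq> 0 \<and> y = wscale n q l x)}"

definition WP :: "nat \<Rightarrow> (nat \<Rightarrow> nat) \<Rightarrow> (nat \<Rightarrow> qbar) set set" where
  "WP n q = nonzero_tuples n // wrel n q"

definition WPQ :: "nat \<Rightarrow> (nat \<Rightarrow> nat) \<Rightarrow> (nat \<Rightarrow> qbar) set set" where
  "WPQ n q = {C \<in> WP n q. \<exists>x\<in>C. \<forall>i\<le>n. x i \<in> \<rat>}"

definition PQ :: "nat \<Rightarrow> (nat \<Rightarrow> qbar) set set" where
  "PQ n = WPQ n (\<lambda>_. 1)"

definition wpoint :: "nat \<Rightarrow> (nat \<Rightarrow> nat) \<Rightarrow> (nat \<Rightarrow> qbar) \<Rightarrow> (nat \<Rightarrow> qbar) set" where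
  "wpoint n q x = wrel n q `` {restrict x {..n}}"

text \<open>The point \<open>[y\<^sub>0 : \<dots> : y\<^sub>n]\<close> of ordinary projective space with rational homogeneous
  coordinates; it is a point only if some coordinate is nonzero.\<close>

definition rat_point :: "nat \<Rightarrow> (nat \<Rightarrow> rat) \<Rightarrow> (nat \<Rightarrow> qbar) set" where
  "rat_point n y = wpoint n (\<lambda>_. 1) (\<lambda>i. of_rat (y i))"


section \<open>The power map to ordinary projective space\<close>

definition weight_lcm :: "nat \<Rightarrow> (nat \<Rightarrow> nat) \<Rightarrow> nat" where
  "weight_lcm n q = Lcm (q ` {..n})"

definition coweight :: "nat \<Rightarrow> (nat \<Rightarrow> nat) \<Rightarrow> nat \<Rightarrow> nat" where
  "coweight n q i = weight_lcm n q div q i"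

text \<open>The union over all representatives is a single class, see \<open>phi_wpoint\<close> below.\<close>

definition phi :: "nat \<Rightarrow> (nat \<Rightarrow> nat) \<Rightarrow> (nat \<Rightarrow> qbar) set \<Rightarrow> (nat \<Rightarrow> qbar) set" where
  "phi n q C = (\<Union>x\<in>C. wpoint n (\<lambda>_. 1) (\<lambda>i. x i ^ coweight n q i))"


section \<open>The arithmetic conditions\<close>

text \<open>The \<open>p\<close>-adic valuation of a nonzero rational; the value at \<open>0\<close> is junk and never used.\<close>

definition rat_val :: "nat \<Rightarrow> rat \<Rightarrow> int" where
  "rat_val p x = (case quotient_of x of (a, b) \<Rightarrow>
     int (multiplicity (int p) a) - int (multiplicity (int p) b))"

text \<open>Both conditions are relative to a set \<open>I\<close> of indices, which is \<open>{..n}\<close> or the set of indices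
  of the nonzero coordinates; the exponents are always those of the full weight vector.\<close>

definition val_cond :: "nat \<Rightarrow> (nat \<Rightarrow> nat) \<Rightarrow> nat set \<Rightarrow> (nat \<Rightarrow> rat) \<Rightarrow> bool" where
  "val_cond n q I y \<longleftrightarrow> (\<forall>p. prime p \<longrightarrow> (\<forall>i\<in>I. \<forall>j\<in>I.
     [rat_val p (y i) = rat_val p (y j)] (mod int (gcd (coweight n q i) (coweight n q j)))))"

definition sign_cond :: "nat \<Rightarrow> (nat \<Rightarrow> nat) \<Rightarrow> nat set \<Rightarrow> (nat \<Rightarrow> rat) \<Rightarrow> bool" where
  "sign_cond n q I y \<longleftrightarrow> (\<forall>i\<in>I. \<forall>j\<in>I.
     even (coweight n q i) \<and> even (coweight n q j) \<longrightarrow> sgn (y i) = sgn (y j))"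

definition Mq :: "nat \<Rightarrow> (nat \<Rightarrow> nat) \<Rightarrow> (nat \<Rightarrow> int) set" where
  "Mq n q = {t \<in> {..n} \<rightarrow>\<^sub>E {0..}. Min (t ` {..n}) = 0 \<and>
     (\<forall>i\<le>n. \<forall>j\<le>n. [t i = t j] (mod int (gcd (coweight n q i) (coweight n q j))))}"


section \<open>Well-definedness\<close>

lemma equiv_wrel: "equiv (nonzero_tuples n) (wrel n q)"
proof (rule equivI)
  show "refl_on (nonzero_tuples n) (wrel n q)"
  proof (rule refl_onI)
    fix x assume x: "x \<in> nonzero_tuples n"
    then have "x = wscale n q 1 x"
      by (auto simp: wscale_def nonzero_tuples_def fun_eq_iff PiE_def extensional_def)
    with x show "(x, x) \<in> wrel n q"
      unfolding wrel_def by (auto intro!: exI[of _ 1])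
  qed
  show "sym (wrel n q)"
  proof (rule symI)
    fix x y assume "(x, y) \<in> wrel n q"
    then obtain l where l: "l \<noteq> 0" "y = wscale n q l x" "x \<in> nonzero_tuples n" "y \<in> nonzero_tuples n"
      by (auto simp: wrel_def)
    then have "x = wscale n q (inverse l) y"
      by (auto simp: wscale_def nonzero_tuples_def fun_eq_iff PiE_def extensional_def field_simps)
    with l show "(y, x) \<in> wrel n q"
      unfolding wrel_def by (auto intro!: exI[of _ "inverse l"])
  qed
  show "trans (wrel n q)"
  proof (rule transI)
    fix x y z assume "(x, y) \<in> wrel n q" "(y, z) \<in> wrel n q"
    then obtain l m where l: "l \<noteq> 0" "y = wscale n q l x" "x \<in> nonzero_tuples n"
        and m: "m \<noteq> 0" "z = wscale n q m y" "z \<in> nonzero_tuples n"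
      by (auto simp: wrel_def)
    have "z = wscale n q (m * l) x"
      unfolding m(2) l(2) by (auto simp: wscale_def fun_eq_iff power_mult_distrib)
    with l m show "(x, z) \<in> wrel n q"
      unfolding wrel_def by (auto intro!: exI[of _ "m * l"])
  qed
qed (auto simp: wrel_def)

lemma phi_wpoint:
  assumes x: "\<exists>i\<le>n. x i \<noteq> 0"
  shows "phi n q (wpoint n q x) = wpoint n (\<lambda>_. 1) (\<lambda>i. x i ^ coweight n q i)"
proof -
  let ?h = "\<lambda>x :: nat \<Rightarrow> qbar. restrict (\<lambda>i. x i ^ coweight n q i) {..n}"
  have mult: "q i * coweight n q i = weight_lcm n q" if "i \<le> n" for i
    using that by (simp add: coweight_def weight_lcm_def)
  have h: "?h u \<in> nonzero_tuples n" if "\<exists>i\<le>n. u i \<noteq> 0" for u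
    using that by (auto simp: nonzero_tuples_def)
  have x': "restrict x {..n} \<in> nonzero_tuples n"
    using x by (auto simp: nonzero_tuples_def)
  have "wpoint n (\<lambda>_. 1) (\<lambda>i. u i ^ coweight n q i) = wpoint n (\<lambda>_. 1) (\<lambda>i. x i ^ coweight n q i)"
    if u: "u \<in> wpoint n q x" for u
  proof -
    obtain l where l: "l \<noteq> 0" "u = wscale n q l (restrict x {..n})" "u \<in> nonzero_tuples n"
      using u by (auto simp: wpoint_def wrel_def)
    have "?h u = wscale n (\<lambda>_. 1) (l ^ weight_lcm n q) (?h x)"
      unfolding l(2)
      by (auto simp: wscale_def fun_eq_iff power_mult_distrib simp flip: power_mult mult)
    moreover have "l ^ weight_lcm n q \<noteq> 0"
      using l(1) by simp
    moreover have "?h u \<in> nonzero_tuples n"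
      using l(3) by (intro h) (simp add: nonzero_tuples_def)
    ultimately have "(?h x, ?h u) \<in> wrel n (\<lambda>_. 1)"
      using h[OF x] unfolding wrel_def by blast
    then show ?thesis
      unfolding wpoint_def using equiv_class_eq[OF equiv_wrel] by metis
  qed
  moreover have "restrict x {..n} \<in> wpoint n q x"
    using equiv_class_self[OF equiv_wrel x'] by (simp add: wpoint_def)
  ultimately show ?thesis
    unfolding phi_def by blast
qed

lemma rat_point_in_PQ: "\<exists>i\<le>n. y i \<noteq> 0 \<Longrightarrow> rat_point n y \<in> PQ n"
proof -
  assume y: "\<exists>i\<le>n. y i \<noteq> 0"
  let ?y = "restrict (\<lambda>i. of_rat (y i)) {..n} :: nat \<Rightarrow> qbar"
  have "?y \<in> nonzero_tuples n"
    using y by (auto simp: nonzero_tuples_def)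
  then show ?thesis
    using equiv_class_self[OF equiv_wrel, of ?y n "\<lambda>_. 1"]
    by (auto simp: PQ_def WPQ_def WP_def rat_point_def wpoint_def intro!: quotientI bexI[of _ ?y])
qed

lemma phi_in_PQ:
  assumes C: "C \<in> WPQ n q"
  shows "phi n q C \<in> PQ n"
proof -
  obtain x where x: "x \<in> C" "\<forall>i\<le>n. x i \<in> \<rat>" and C': "C \<in> nonzero_tuples n // wrel n q"
    using C by (auto simp: WPQ_def WP_def)
  have xt: "x \<in> nonzero_tuples n"
    using x(1) C' in_quotient_imp_subset[OF equiv_wrel] by blast
  have "C = wrel n q `` {x}"
    using C' x(1) by (metis equiv_class_eq[OF equiv_wrel] quotientE Image_singleton_iff)
  also have "\<dots> = wpoint n q x"
    using xt by (simp add: wpoint_def nonzero_tuples_def PiE_def extensional_restrict)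
  finally have C_eq: "C = wpoint n q x" .
  obtain r where r: "\<And>i. i \<le> n \<Longrightarrow> x i = of_rat (r i)"
    using x(2) unfolding Rats_def image_def by simp metis
  have nz: "\<exists>i\<le>n. x i \<noteq> 0"
    using xt by (auto simp: nonzero_tuples_def)
  have "phi n q C = wpoint n (\<lambda>_. 1) (\<lambda>i. x i ^ coweight n q i)"
    using phi_wpoint[OF nz] C_eq by simp
  also have "\<dots> = rat_point n (\<lambda>i. r i ^ coweight n q i)"
    unfolding rat_point_def wpoint_def
    by (rule arg_cong[where f = "\<lambda>u. wrel n (\<lambda>_. 1) `` {u}"]) (auto simp: fun_eq_iff r of_rat_power)
  also have "\<dots> \<in> PQ n"
    using nz r by (intro rat_point_in_PQ) auto
  finally show ?thesis .
qed

end

theory Submission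
  imports Defs "HOL-Computational_Algebra.Nth_Powers"
begin

text \<open>A rational preimage exists iff some rational \<open>l \<noteq> 0\<close> makes every nonzero \<open>l y\<^sub>i\<close> an
  \<open>n\<^sub>i\<close>-th power in the rationals. For each prime \<open>p\<close> this asks
  \<open>v\<^sub>p(l) \<equiv> - v\<^sub>p(y\<^sub>i) (mod n\<^sub>i)\<close> for all \<open>i\<close>, a system that is solvable iff it is
  pairwise compatible modulo \<open>gcd(n\<^sub>i, n\<^sub>j)\<close>; the sign of \<open>l\<close> is dictated by the coordinates with
  even \<open>n\<^sub>i\<close>. Only finitely many primes occur, so the local solutions assemble to one \<open>l\<close>.\<close>

section \<open>Valuations and roots of rational numbers\<close>

lemma rat_val_of_int: "rat_val p (of_int a) = int (multiplicity (int p) a)"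
  by (simp add: rat_val_def)

lemma multiplicity_int_nat: "multiplicity (int p) (int m) = multiplicity p m"
  by (simp add: multiplicity_def flip: of_nat_power)

lemma rat_val_of_nat: "rat_val p (of_nat m) = int (multiplicity p m)"
  using rat_val_of_int[of p "int m"] by (simp add: multiplicity_int_nat)

text \<open>Cross-multiplying with the reduced fraction \<open>c / d\<close> gives
  \<open>a * d = c * b\<close>, and additivity of the multiplicity at a prime shows that the
  difference of multiplicities is the same for every fraction representing the number.\<close>

lemma rat_val_divide_int:
  assumes "prime p" "a \<noteq> 0" "b \<noteq> 0"
  shows "rat_val p (of_int a / of_int b) =
           int (multiplicity (int p) a) - int (multiplicity (int p) b)"
proof -
  obtain c d where cd: "quotient_of (of_int a / of_int b) = (c, d)"
    by force
  then have eq: "of_int a / of_int b = (of_int c / of_int d :: rat)" and d: "d > 0"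
    by (auto dest: quotient_of_div quotient_of_denom_pos)
  with assms have c: "c \<noteq> 0"
    by auto
  from eq d assms have "of_int (a * d) = (of_int (c * b) :: rat)"
    by (simp add: field_simps)
  then have "a * d = c * b"
    by (simp only: of_int_eq_iff)
  moreover have "prime_elem (int p)"
    using assms by simp
  ultimately have "multiplicity (int p) a + multiplicity (int p) d =
      multiplicity (int p) c + multiplicity (int p) b"
    using assms c d by (metis less_irrefl prime_elem_multiplicity_mult_distrib)
  then show ?thesis
    by (simp add: rat_val_def cd)
qed

lemma rat_val_mult:
  assumes p: "prime p" and "x \<noteq> 0" "y \<noteq> 0"
  shows "rat_val p (x * y) = rat_val p x + rat_val p y"
proof -
  obtain a b where ab: "quotient_of x = (a, b)" by force
  obtain c d where cd: "quotient_of y = (c, d)" by force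
  have x: "x = of_int a / of_int b" "a \<noteq> 0" "b \<noteq> 0"
    using ab quotient_of_div[OF ab] quotient_of_denom_pos[OF ab] assms by auto
  have y: "y = of_int c / of_int d" "c \<noteq> 0" "d \<noteq> 0"
    using cd quotient_of_div[OF cd] quotient_of_denom_pos[OF cd] assms by auto
  have "x * y = of_int (a * c) / of_int (b * d)"
    by (simp add: x y)
  then have "rat_val p (x * y) = int (multiplicity (int p) (a * c)) - int (multiplicity (int p) (b * d))"
    using rat_val_divide_int[OF p, of "a * c" "b * d"] x(2,3) y(2,3) by simp
  moreover have "prime_elem (int p)"
    using p by simp
  moreover have "rat_val p x = int (multiplicity (int p) a) - int (multiplicity (int p) b)"
    "rat_val p y = int (multiplicity (int p) c) - int (multiplicity (int p) d)"
    by (simp_all add: rat_val_def ab cd)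
  ultimately show ?thesis
    using x(2,3) y(2,3) by (simp add: prime_elem_multiplicity_mult_distrib)
qed

lemma rat_val_power:
  assumes "prime p" "x \<noteq> 0"
  shows "rat_val p (x ^ k) = int k * rat_val p x"
  using assms by (induction k) (auto simp: rat_val_mult algebra_simps, simp add: rat_val_def)

lemma rat_val_sgn: "x \<noteq> 0 \<Longrightarrow> rat_val p (sgn x) = 0"
  by (auto simp: sgn_if rat_val_def)

text \<open>Such a prime divides the numerator or the denominator. Finiteness is what allows a
  scaling factor to be written as a finite product of prime powers.\<close>

lemma finite_rat_val_support:
  assumes "x \<noteq> 0"
  shows "finite {p. prime p \<and> rat_val p x \<noteq> 0}"
proof -
  obtain a b where ab: "quotient_of x = (a, b)" by force
  have nz: "a \<noteq> 0" "b \<noteq> 0"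
    using quotient_of_div[OF ab] quotient_of_denom_pos[OF ab] assms by auto
  have "{p. prime p \<and> rat_val p x \<noteq> 0} \<subseteq> {p. p dvd nat \<bar>a * b\<bar>}"
  proof safe
    fix p :: nat
    assume "prime p" "rat_val p x \<noteq> 0"
    then have "int p dvd a \<or> int p dvd b"
      by (auto simp: rat_val_def ab) (metis not_dvd_imp_multiplicity_0)
    then have "int p dvd a * b"
      by auto
    then show "p dvd nat \<bar>a * b\<bar>"
      by (simp only: flip: int_dvd_int_iff) simp
  qed
  moreover have "finite {p. p dvd nat \<bar>a * b\<bar>}"
    using nz by (intro finite_divisors_nat) auto
  ultimately show ?thesis
    by (rule finite_subset)
qed

text \<open>In lowest terms a prime divides at most one of numerator and denominator, so
  divisibility of the valuation by \<open>k\<close> passes to both multiplicities, and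
  \<open>\<bar>a\<bar>\<close> and \<open>b\<close> are \<open>k\<close>-th powers of naturals. It
  remains to restore the sign.\<close>

lemma rat_nth_root_exists:
  fixes x :: rat
  assumes x: "x \<noteq> 0" and k: "k > 0"
    and val: "\<And>p. prime p \<Longrightarrow> int k dvd rat_val p x"
    and pos: "even k \<Longrightarrow> x > 0"
  shows "\<exists>r. r ^ k = x"
proof -
  obtain a b where ab: "quotient_of x = (a, b)" by force
  have b: "b > 0" and x_eq: "x = of_int a / of_int b" and cop: "coprime a b"
    using ab by (auto dest: quotient_of_div quotient_of_denom_pos quotient_of_coprime)
  have root: "k dvd multiplicity p (nat \<bar>a\<bar>) \<and> k dvd multiplicity p (nat b)" if p: "prime p" for p
  proof -
    have a': "multiplicity p (nat \<bar>a\<bar>) = multiplicity (int p) a"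
      using multiplicity_int_nat[of p "nat \<bar>a\<bar>"] multiplicity_normalize_right[of "int p" a]
      by simp
    have b': "multiplicity p (nat b) = multiplicity (int p) b"
      using multiplicity_int_nat[of p "nat b"] b by simp
    have "\<not> (int p dvd a \<and> int p dvd b)"
      using coprime_common_divisor[OF cop, of "int p"] prime_gt_1_nat[OF p] by auto
    then have "multiplicity (int p) a = 0 \<or> multiplicity (int p) b = 0"
      by (cases "int p dvd a") (simp_all add: not_dvd_imp_multiplicity_0)
    moreover have "int k dvd int (multiplicity (int p) a) - int (multiplicity (int p) b)"
      using val[OF p] by (simp add: rat_val_def ab)
    ultimately show ?thesis
      unfolding a' b' by auto
  qed
  then have "is_nth_power k (nat \<bar>a\<bar>)" "is_nth_power k (nat b)"
    using k by (simp_all add: is_nth_power_conv_multiplicity_nat)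
  then obtain c d where cd: "nat \<bar>a\<bar> = c ^ k" "nat b = d ^ k"
    by (auto simp: is_nth_power_def)
  have a_eq: "\<bar>a\<bar> = int c ^ k"
    using arg_cong[OF cd(1), of int] by simp
  have b_eq: "b = int d ^ k"
    using arg_cong[OF cd(2), of int] b by simp
  have "\<bar>x\<bar> = \<bar>of_int a\<bar> / of_int b"
    using b by (simp add: x_eq)
  also have "\<dots> = (of_nat c / of_nat d) ^ k"
    unfolding of_int_abs [symmetric] a_eq by (simp add: b_eq power_divide)
  finally have abs: "(of_nat c / of_nat d) ^ k = \<bar>x\<bar>" ..
  \<comment> \<open>For odd \<open>k\<close> both signs are their own \<open>k\<close>-th powers;
    for even \<open>k\<close> the assumption \<open>pos\<close> leaves only the sign 1.\<close>
  have "sgn x ^ k = sgn x"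
    using pos x by (cases "even k") (auto simp: sgn_if)
  then have "(sgn x * (of_nat c / of_nat d)) ^ k = x"
    by (simp only: power_mult_distrib abs sgn_mult_abs)
  then show ?thesis ..
qed


section \<open>Simultaneous congruences for non-coprime moduli\<close>

text \<open>\<open>gcd c\<close> distributes over \<open>lcm\<close>, so
  \<open>gcd c (Lcm A)\<close> is built as an lcm of divisors of \<open>k\<close>. This merges
  pairwise compatibility conditions into one condition on the lcm of the moduli.\<close>

lemma gcd_Lcm_dvdI:
  fixes c k :: int
  assumes "finite A" "\<And>a. a \<in> A \<Longrightarrow> gcd c a dvd k"
  shows "gcd c (Lcm A) dvd k"
  using assms by (induction A) (auto simp: gcd_lcm_distrib)

text \<open>The Chinese remainder theorem for moduli that need not be coprime, adding one congruence
  at a time. A solution for \<open>I\<close> stays one after adding a multiple of the lcm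
  \<open>L\<close> of its moduli, and that freedom suffices to meet the new congruence.\<close>

lemma cong_system_solvable:
  fixes a m :: "'i \<Rightarrow> int"
  assumes "finite I" "\<And>i j. i \<in> I \<Longrightarrow> j \<in> I \<Longrightarrow> [a i = a j] (mod gcd (m i) (m j))"
  shows "\<exists>x. \<forall>i\<in>I. [x = a i] (mod m i)"
  using assms
proof (induction I)
  case empty
  show ?case by simp
next
  case (insert j I)
  then obtain x where x: "\<And>i. i \<in> I \<Longrightarrow> [x = a i] (mod m i)"
    by (metis insertCI)
  define L where "L = Lcm (m ` I)"
  have "gcd (m j) (m i) dvd a j - x" if i: "i \<in> I" for i
  proof -
    have "[x = a i] (mod gcd (m j) (m i))"
      using x[OF i] by (rule cong_dvd_modulus) simp
    moreover have "[a j = a i] (mod gcd (m j) (m i))"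
      using insert.prems i by blast
    ultimately show ?thesis
      by (metis cong_iff_dvd_diff cong_sym cong_trans)
  qed
  then have "gcd L (m j) dvd a j - x"
    unfolding L_def using insert.hyps by (subst gcd.commute) (auto intro: gcd_Lcm_dvdI)
  \<comment> \<open>Bezout: a linear congruence with coefficient \<open>L\<close> modulo
    \<open>m j\<close> is solvable as soon as \<open>gcd L (m j)\<close> divides the right-hand
    side.\<close>
  then obtain t where t: "[L * t = a j - x] (mod m j)"
    using cong_solve_dvd_int by blast
  have "[x + L * t = a i] (mod m i)" if i: "i \<in> I" for i
  proof -
    have "m i dvd L * t"
      unfolding L_def using i by (intro dvd_mult2 dvd_Lcm) auto
    then have "[x + L * t = a i + 0] (mod m i)"
      by (intro cong_add x i) (simp add: cong_0_iff)
    then show ?thesis by simp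
  qed
  moreover have "[x + L * t = a j] (mod m j)"
    using cong_add[OF cong_refl[of x] t] by simp
  ultimately show ?case by auto
qed

text \<open>Reducing an integer solution modulo the product of the moduli makes it nonnegative, so
  that it can serve as the exponent of a prime.\<close>

lemma cong_system_solvable_nat:
  fixes a :: "'i \<Rightarrow> int" and m :: "'i \<Rightarrow> nat"
  assumes "finite I" "\<And>i. i \<in> I \<Longrightarrow> m i > 0"
    and "\<And>i j. i \<in> I \<Longrightarrow> j \<in> I \<Longrightarrow> [a i = a j] (mod int (gcd (m i) (m j)))"
  shows "\<exists>x::nat. \<forall>i\<in>I. [int x = a i] (mod int (m i))"
proof -
  obtain x where x: "\<forall>i\<in>I. [x = a i] (mod int (m i))"
    using cong_system_solvable[of I a "\<lambda>i. int (m i)"] assms by (auto simp: gcd_int_int_eq)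
  define M where "M = (\<Prod>i\<in>I. int (m i))"
  have M: "M > 0"
    unfolding M_def using assms by (intro prod_pos) auto
  have "[int (nat (x mod M)) = a i] (mod int (m i))" if i: "i \<in> I" for i
  proof -
    have "int (m i) dvd M"
      unfolding M_def using assms i by (intro dvd_prodI) auto
    then have "[x mod M = x] (mod int (m i))"
      by (rule cong_dvd_modulus[rotated]) (simp add: cong_def)
    then show ?thesis
      using M x i by (auto intro: cong_trans)
  qed
  then show ?thesis by blast
qed


section \<open>Common scaling to perfect powers\<close>

text \<open>The arithmetic core, free of projective spaces; \<open>I\<close> is left arbitrary so
  that it can be the set of indices of nonzero coordinates. For sufficiency the witness is
  \<open>l = s * N\<close>, where the natural number \<open>N\<close> adjusts the valuations and the
  sign \<open>s\<close> ensures positivity under even exponents.\<close>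

lemma ex_scaling_to_powers_iff:
  fixes y :: "'i \<Rightarrow> rat" and m :: "'i \<Rightarrow> nat"
  assumes I: "finite I" and m: "\<And>i. i \<in> I \<Longrightarrow> m i > 0" and y: "\<And>i. i \<in> I \<Longrightarrow> y i \<noteq> 0"
  shows "(\<exists>l. l \<noteq> 0 \<and> (\<forall>i\<in>I. \<exists>r. r ^ m i = l * y i)) \<longleftrightarrow>
    (\<forall>p. prime p \<longrightarrow> (\<forall>i\<in>I. \<forall>j\<in>I. [rat_val p (y i) = rat_val p (y j)] (mod int (gcd (m i) (m j))))) \<and>
    (\<forall>i\<in>I. \<forall>j\<in>I. even (m i) \<and> even (m j) \<longrightarrow> sgn (y i) = sgn (y j))"
    (is "?L \<longleftrightarrow> ?V \<and> ?S")
proof (intro iffI conjI)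
  assume ?L
  then obtain l r where l: "l \<noteq> 0" and r: "\<And>i. i \<in> I \<Longrightarrow> r i ^ m i = l * y i"
    by metis
  have r0: "r i \<noteq> 0" if "i \<in> I" for i
    using r[OF that] l y[OF that] m[OF that] by (auto simp: zero_power)
  show ?V
  proof (intro allI impI ballI)
    fix p :: nat and i j assume p: "prime p" and ij: "i \<in> I" "j \<in> I"
    have eq: "rat_val p l + rat_val p (y i) = int (m i) * rat_val p (r i)" if "i \<in> I" for i
      using rat_val_power[OF p r0[OF that], of "m i"] r[OF that] rat_val_mult[OF p l y[OF that]]
      by simp
    \<comment> \<open>The valuation of \<open>l\<close> is common to both indices and
      cancels.\<close>
    have "rat_val p (y i) - rat_val p (y j) = int (m i) * rat_val p (r i) - int (m j) * rat_val p (r j)"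
      using eq[OF ij(1)] eq[OF ij(2)] by simp
    moreover have "int (gcd (m i) (m j)) dvd int (m i) * rat_val p (r i) - int (m j) * rat_val p (r j)"
      by (intro dvd_diff dvd_mult2) auto
    ultimately show "[rat_val p (y i) = rat_val p (y j)] (mod int (gcd (m i) (m j)))"
      by (simp add: cong_iff_dvd_diff)
  qed
  show ?S
  proof (intro ballI impI)
    fix i j assume ij: "i \<in> I" "j \<in> I" and ev: "even (m i) \<and> even (m j)"
    \<comment> \<open>An even power of a nonzero rational is positive, so every such
      \<open>y i\<close> shares the sign of \<open>l\<close>.\<close>
    have "l * y i > 0" if "i \<in> I" "even (m i)" for i
    proof -
      have "r i ^ m i > 0"
        using that r0[OF that(1)] by (simp add: zero_less_power_eq)
      then show ?thesis
        by (simp only: r[OF that(1)])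
    qed
    then have "l * y i > 0" "l * y j > 0"
      using ij ev by auto
    then show "sgn (y i) = sgn (y j)"
      by (auto simp: zero_less_mult_iff)
  qed
next
  assume VS: "?V \<and> ?S"
  from VS have V: ?V by (rule conjunct1)
  from VS have S: ?S by (rule conjunct2)
  \<comment> \<open>\<open>e\<close> is the exponent that \<open>l\<close> is to have at
    \<open>p\<close>: it makes the valuation of each \<open>l * y i\<close> divisible by
    \<open>m i\<close>.\<close>
  have "\<exists>e::nat. \<forall>i\<in>I. [int e = - rat_val p (y i)] (mod int (m i))" if "prime p" for p
  proof (rule cong_system_solvable_nat[OF I m])
    fix i j assume "i \<in> I" "j \<in> I"
    then show "[- rat_val p (y i) = - rat_val p (y j)] (mod int (gcd (m i) (m j)))"
      unfolding cong_minus_minus_iff using V that by blast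
  qed
  then obtain e :: "nat \<Rightarrow> nat"
    where e: "\<And>p i. prime p \<Longrightarrow> i \<in> I \<Longrightarrow> [int (e p) = - rat_val p (y i)] (mod int (m i))"
    by metis
  \<comment> \<open>Outside \<open>P\<close> all the \<open>y i\<close> have valuation 0, so
    exponent 0 works there whatever \<open>e p\<close> is, and the product defining \<open>N\<close>
    can be limited to \<open>P\<close>.\<close>
  define P where "P = (\<Union>i\<in>I. {p. prime p \<and> rat_val p (y i) \<noteq> 0})"
  have P: "finite P" "\<And>p. p \<in> P \<Longrightarrow> prime p"
    unfolding P_def using I y finite_rat_val_support by auto
  define N where "N = (\<Prod>p\<in>P. p ^ e p)"
  have N: "N > 0"
    unfolding N_def using P(2) by (intro prod_pos) (auto simp: prime_gt_0_nat)
  \<comment> \<open>The common sign of the coordinates with even exponent, or 1 if there are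
    none.\<close>
  obtain s :: rat where s: "\<bar>s\<bar> = 1" "\<And>i. i \<in> I \<Longrightarrow> even (m i) \<Longrightarrow> s * y i > 0"
  proof (cases "\<exists>i\<in>I. even (m i)")
    case True
    then obtain j where j: "j \<in> I" "even (m j)" by blast
    show ?thesis
    proof
      show "\<bar>sgn (y j)\<bar> = 1"
        using y j by (auto simp: sgn_if)
      show "sgn (y j) * y i > 0" if "i \<in> I" "even (m i)" for i
      proof -
        have "sgn (y j) = sgn (y i)"
          using S j that by blast
        then show ?thesis
          using y[OF that(1)] by (simp add: mult.commute flip: abs_sgn)
      qed
    qed
  qed (use that[of 1] in auto)
  have s0: "s \<noteq> 0"
    using s(1) by auto
  have s_val: "rat_val p s = 0" for p
    using abs_mult_sgn[of s] s(1) rat_val_sgn[OF s0, of p] by simp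
  define l where "l = s * of_nat N"
  have l: "l \<noteq> 0"
    using s0 N by (simp add: l_def)
  have "\<exists>r. r ^ m i = l * y i" if i: "i \<in> I" for i
  proof (rule rat_nth_root_exists)
    show "l * y i \<noteq> 0" "m i > 0"
      using l y[OF i] m[OF i] by auto
    show "l * y i > 0" if "even (m i)"
    proof -
      have "l * y i = of_nat N * (s * y i)"
        by (simp add: l_def mult_ac)
      then show ?thesis
        using s(2)[OF i that] N by (simp only: mult_pos_pos of_nat_0_less_iff)
    qed
    fix p :: nat assume p: "prime p"
    have "multiplicity p N = (if p \<in> P then e p else 0)"
      unfolding N_def using P p by (intro multiplicity_prod_prime_powers) auto
    then have "rat_val p (l * y i) = (if p \<in> P then int (e p) else 0) + rat_val p (y i)"
      using p s0 N y[OF i] by (simp add: l_def rat_val_mult s_val rat_val_of_nat)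
    moreover have "int (m i) dvd int (e p) + rat_val p (y i)"
      using e[OF p i] by (simp add: cong_iff_dvd_diff)
    moreover have "rat_val p (y i) = 0" if "p \<notin> P"
      using that i p by (auto simp: P_def)
    ultimately show "int (m i) dvd rat_val p (l * y i)"
      by auto
  qed
  with l show ?L by blast
qed


section \<open>Points with rational coordinates\<close>

text \<open>If the classes agree, then \<open>x\<close> lies in the class of \<open>y\<close>, so
  both are nonzero tuples related by a scaling, which symmetry turns around. Conversely, scaling by
  a nonzero factor keeps the tuple nonzero.\<close>

lemma wpoint_eq_iff:
  assumes x: "\<exists>i\<le>n. x i \<noteq> 0"
  shows "wpoint n q x = wpoint n q y \<longleftrightarrow> (\<exists>l. l \<noteq> 0 \<and> (\<forall>i\<le>n. y i = l ^ q i * x i))"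
proof
  have x': "restrict x {..n} \<in> nonzero_tuples n"
    using x by (auto simp: nonzero_tuples_def)
  {
    assume "wpoint n q x = wpoint n q y"
    then have "restrict x {..n} \<in> wpoint n q y"
      using equiv_class_self[OF equiv_wrel x', of q] by (simp add: wpoint_def)
    then have "(restrict y {..n}, restrict x {..n}) \<in> wrel n q"
      by (simp add: wpoint_def)
    moreover have "sym (wrel n q)"
      using equiv_wrel by (rule equivE)
    ultimately have "(restrict x {..n}, restrict y {..n}) \<in> wrel n q"
      by (rule symD[rotated])
    then obtain l where l: "l \<noteq> 0" "restrict y {..n} = wscale n q l (restrict x {..n})"
      unfolding wrel_def by blast
    have "y i = l ^ q i * x i" if "i \<le> n" for i
      using fun_cong[OF l(2), of i] that by (simp add: wscale_def)
    with l(1) show "\<exists>l. l \<noteq> 0 \<and> (\<forall>i\<le>n. y i = l ^ q i * x i)"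
      by blast
  }
  assume "\<exists>l. l \<noteq> 0 \<and> (\<forall>i\<le>n. y i = l ^ q i * x i)"
  then obtain l where l: "l \<noteq> 0" "\<forall>i\<le>n. y i = l ^ q i * x i"
    by blast
  then have "restrict y {..n} = wscale n q l (restrict x {..n})"
    by (auto simp: wscale_def fun_eq_iff)
  moreover have "restrict y {..n} \<in> nonzero_tuples n"
    using x l by (auto simp: nonzero_tuples_def)
  ultimately have "(restrict x {..n}, restrict y {..n}) \<in> wrel n q"
    using x' l(1) by (auto simp: wrel_def)
  then show "wpoint n q x = wpoint n q y"
    unfolding wpoint_def by (rule equiv_class_eq[OF equiv_wrel])
qed

text \<open>The factor is a priori algebraic, but a coordinate with \<open>x j \<noteq> 0\<close>
  forces it to be \<open>y j / x j\<close>, which is rational. This moves the whole question from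
  the algebraic closure to the rationals.\<close>

lemma rat_point_eq_iff:
  assumes x: "\<exists>i\<le>n. x i \<noteq> 0"
  shows "rat_point n x = rat_point n y \<longleftrightarrow> (\<exists>l. l \<noteq> 0 \<and> (\<forall>i\<le>n. y i = l * x i))"
proof -
  have "rat_point n x = rat_point n y \<longleftrightarrow>
      (\<exists>l::qbar. l \<noteq> 0 \<and> (\<forall>i\<le>n. of_rat (y i) = l * of_rat (x i)))"
    unfolding rat_point_def using x by (subst wpoint_eq_iff) auto
  also have "\<dots> \<longleftrightarrow> (\<exists>l. l \<noteq> 0 \<and> (\<forall>i\<le>n. y i = l * x i))"
  proof
    assume "\<exists>l::qbar. l \<noteq> 0 \<and> (\<forall>i\<le>n. of_rat (y i) = l * of_rat (x i))"
    then obtain l :: qbar where l: "l \<noteq> 0" "\<And>i. i \<le> n \<Longrightarrow> of_rat (y i) = l * of_rat (x i)"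
      by blast
    obtain j where j: "j \<le> n" "x j \<noteq> 0"
      using x by blast
    have l_eq: "l = of_rat (y j / x j)"
      using l(2)[OF j(1)] j(2) by (simp add: of_rat_divide)
    have "y i = y j / x j * x i" if "i \<le> n" for i
      using l(2)[OF that] unfolding l_eq by (simp only: of_rat_eq_iff flip: of_rat_mult)
    moreover have "y j / x j \<noteq> 0"
      using l(1) l_eq by auto
    ultimately show "\<exists>l. l \<noteq> 0 \<and> (\<forall>i\<le>n. y i = l * x i)"
      by blast
  next
    assume "\<exists>l. l \<noteq> 0 \<and> (\<forall>i\<le>n. y i = l * x i)"
    then obtain l where "l \<noteq> 0" "\<forall>i\<le>n. y i = l * x i"
      by blast
    then show "\<exists>l::qbar. l \<noteq> 0 \<and> (\<forall>i\<le>n. of_rat (y i) = l * of_rat (x i))"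
      by (intro exI[of _ "of_rat l"]) (auto simp: of_rat_mult)
  qed
  finally show ?thesis .
qed

text \<open>A class is determined by any of its members, here a rational one. Quantifying over
  rational points thus becomes quantifying over rational tuples.\<close>

lemma WPQ_iff:
  "C \<in> WPQ n q \<longleftrightarrow> (\<exists>r. (\<exists>i\<le>n. r i \<noteq> 0) \<and> C = wpoint n q (\<lambda>i. of_rat (r i)))"
proof
  assume C: "C \<in> WPQ n q"
  obtain x where x: "x \<in> C" "\<forall>i\<le>n. x i \<in> \<rat>" and C': "C \<in> nonzero_tuples n // wrel n q"
    using C by (auto simp: WPQ_def WP_def)
  have xt: "x \<in> nonzero_tuples n"
    using x(1) C' in_quotient_imp_subset[OF equiv_wrel] by blast
  obtain r where r: "\<And>i. i \<le> n \<Longrightarrow> x i = of_rat (r i)"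
    using x(2) unfolding Rats_def image_def by simp metis
  have "x = restrict (\<lambda>i. of_rat (r i)) {..n}"
    using xt r by (auto simp: fun_eq_iff nonzero_tuples_def PiE_def extensional_def)
  moreover have "C = wrel n q `` {x}"
    using C' x(1) by (metis equiv_class_eq[OF equiv_wrel] quotientE Image_singleton_iff)
  moreover have "\<exists>i\<le>n. r i \<noteq> 0"
    using xt r by (auto simp: nonzero_tuples_def)
  ultimately show "\<exists>r. (\<exists>i\<le>n. r i \<noteq> 0) \<and> C = wpoint n q (\<lambda>i. of_rat (r i))"
    by (auto simp: wpoint_def)
next
  assume "\<exists>r. (\<exists>i\<le>n. r i \<noteq> 0) \<and> C = wpoint n q (\<lambda>i. of_rat (r i))"
  then obtain r where r: "\<exists>i\<le>n. r i \<noteq> 0" and C: "C = wpoint n q (\<lambda>i. of_rat (r i))"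
    by blast
  let ?r = "restrict (\<lambda>i. of_rat (r i)) {..n} :: nat \<Rightarrow> qbar"
  have "?r \<in> nonzero_tuples n"
    using r by (auto simp: nonzero_tuples_def)
  then show "C \<in> WPQ n q"
    using equiv_class_self[OF equiv_wrel, of ?r n q]
    by (auto simp: WPQ_def WP_def C wpoint_def intro!: quotientI bexI[of _ ?r])
qed

section \<open>Rational preimages as simultaneous perfect powers\<close>

lemma coweight_pos:
  assumes "\<forall>i\<le>n. q i > 0" "i \<le> n"
  shows "coweight n q i > 0"
proof -
  have "weight_lcm n q \<noteq> 0"
    using assms unfolding weight_lcm_def by (subst Lcm_0_iff) auto
  moreover have "q i dvd weight_lcm n q"
    using assms by (simp add: weight_lcm_def)
  ultimately show ?thesis
    using assms by (auto simp: coweight_def elim: dvdE)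
qed

text \<open>The image of a rational tuple \<open>r\<close> has coordinates
  \<open>r i ^ coweight n q i\<close>, so it equals the given point iff these are
  \<open>l * y i\<close> for one rational \<open>l \<noteq> 0\<close>. Where \<open>y i = 0\<close>
  the root 0 always serves, so only the nonzero coordinates impose a condition.\<close>

lemma rational_preimage_iff:
  assumes q: "\<forall>i\<le>n. q i > 0" and y: "\<exists>i\<le>n. y i \<noteq> 0"
  shows "(\<exists>C\<in>WPQ n q. phi n q C = rat_point n y) \<longleftrightarrow>
    (\<exists>l. l \<noteq> 0 \<and> (\<forall>i\<in>{i. i \<le> n \<and> y i \<noteq> 0}. \<exists>r. r ^ coweight n q i = l * y i))"
proof -
  have phi: "phi n q (wpoint n q (\<lambda>i. of_rat (r i))) = rat_point n (\<lambda>i. r i ^ coweight n q i)"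
    if "\<exists>i\<le>n. r i \<noteq> 0" for r
    using that by (subst phi_wpoint) (auto simp: rat_point_def of_rat_power)
  have "(\<exists>C\<in>WPQ n q. phi n q C = rat_point n y) \<longleftrightarrow>
      (\<exists>r. (\<exists>i\<le>n. r i \<noteq> 0) \<and> phi n q (wpoint n q (\<lambda>i. of_rat (r i))) = rat_point n y)"
    by (simp only: Bex_def WPQ_iff) blast
  also have "\<dots> \<longleftrightarrow> (\<exists>r. (\<exists>i\<le>n. r i \<noteq> 0) \<and>
      rat_point n y = rat_point n (\<lambda>i. r i ^ coweight n q i))"
    by (intro ex_cong1 conj_cong refl) (auto simp: phi)
  also have "\<dots> \<longleftrightarrow> (\<exists>r. (\<exists>i\<le>n. r i \<noteq> 0) \<and>
      (\<exists>l. l \<noteq> 0 \<and> (\<forall>i\<le>n. r i ^ coweight n q i = l * y i)))"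
    unfolding rat_point_eq_iff[OF y] ..
  also have "\<dots> \<longleftrightarrow> (\<exists>l. l \<noteq> 0 \<and> (\<forall>i\<in>{i. i \<le> n \<and> y i \<noteq> 0}. \<exists>r. r ^ coweight n q i = l * y i))"
  proof
    assume "\<exists>l. l \<noteq> 0 \<and> (\<forall>i\<in>{i. i \<le> n \<and> y i \<noteq> 0}. \<exists>r. r ^ coweight n q i = l * y i)"
    then obtain l r where l: "l \<noteq> 0"
      and r: "\<And>i. i \<le> n \<Longrightarrow> y i \<noteq> 0 \<Longrightarrow> r i ^ coweight n q i = l * y i"
      by simp metis
    \<comment> \<open>The roots \<open>r i\<close> are only controlled where
      \<open>y i \<noteq> 0\<close>; elsewhere 0 is a root of \<open>l * 0\<close> because the
      exponent is positive.\<close>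
    define r' where "r' i = (if y i = 0 then 0 else r i)" for i
    have r': "r' i ^ coweight n q i = l * y i" if "i \<le> n" for i
      using r[OF that] coweight_pos[OF q that] by (auto simp: r'_def zero_power)
    obtain j where j: "j \<le> n" "y j \<noteq> 0"
      using y by blast
    have "r' j \<noteq> 0"
      using r'[OF j(1)] l j(2) coweight_pos[OF q j(1)] by (auto simp: zero_power)
    with l r' j(1) show "\<exists>r. (\<exists>i\<le>n. r i \<noteq> 0) \<and>
        (\<exists>l. l \<noteq> 0 \<and> (\<forall>i\<le>n. r i ^ coweight n q i = l * y i))"
      by blast
  qed blast
  finally show ?thesis .
qed

lemma preimage_criterion:
  assumes q: "\<forall>i\<le>n. q i > 0" and y: "\<exists>i\<le>n. y i \<noteq> 0"
  shows "(\<exists>C\<in>WPQ n q. phi n q C = rat_point n y) \<longleftrightarrow>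
    val_cond n q {i. i \<le> n \<and> y i \<noteq> 0} y \<and> sign_cond n q {i. i \<le> n \<and> y i \<noteq> 0} y"
  unfolding rational_preimage_iff[OF q y] val_cond_def sign_cond_def
  using coweight_pos[OF q] by (intro ex_scaling_to_powers_iff) auto

section \<open>Condition (i) on primitive integral representatives\<close>

text \<open>Scaling adds the valuation of \<open>l\<close> to both sides of every congruence, so
  condition (i) depends on the projective point alone.\<close>

lemma val_cond_scale:
  assumes "l \<noteq> 0" "\<And>i. i \<in> I \<Longrightarrow> x i \<noteq> 0" "\<And>i. i \<in> I \<Longrightarrow> y i = l * x i"
  shows "val_cond n q I y \<longleftrightarrow> val_cond n q I x"
  unfolding val_cond_def using assms
  by (intro all_cong ball_cong refl) (simp add: rat_val_mult cong_add_lcancel)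

text \<open>Valuations of integers are nonnegative, and primitivity means that each prime fails to
  divide some coordinate, so the minimum is 0. What remains of membership in \<open>Mq\<close> is
  exactly the congruences.\<close>

lemma val_cond_iff_Mq:
  fixes z :: "nat \<Rightarrow> int"
  assumes z: "\<And>i. i \<le> n \<Longrightarrow> z i \<noteq> 0" and gcd: "Gcd (z ` {..n}) = 1"
  shows "val_cond n q {..n} (\<lambda>i. of_int (z i)) \<longleftrightarrow>
    (\<forall>p. prime p \<longrightarrow> (\<lambda>i\<in>{..n}. rat_val p (of_int (z i))) \<in> Mq n q)"
proof -
  have "Min ((\<lambda>i\<in>{..n}. rat_val p (of_int (z i))) ` {..n}) = 0" if p: "prime p" for p
  proof (rule Min_eqI)
    have "\<exists>i\<le>n. \<not> int p dvd z i"
    proof (rule ccontr)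
      assume "\<not> ?thesis"
      then have "int p dvd Gcd (z ` {..n})"
        by (intro Gcd_greatest) auto
      with gcd p show False
        by auto
    qed
    then obtain i where "i \<le> n" "rat_val p (of_int (z i)) = 0"
      by (auto simp: rat_val_of_int not_dvd_imp_multiplicity_0)
    then show "0 \<in> (\<lambda>i\<in>{..n}. rat_val p (of_int (z i))) ` {..n}"
      by (intro image_eqI[of _ _ i]) auto
  qed (auto simp: rat_val_of_int)
  then show ?thesis
    by (auto simp: val_cond_def Mq_def rat_val_of_int)
qed

theorem proposition4:
  fixes n :: nat and q :: "nat \<Rightarrow> nat"
  assumes "\<forall>i\<le>n. q i > 0"
  shows
    "(\<forall>y :: nat \<Rightarrow> rat. (\<forall>i\<le>n. y i \<noteq> 0) \<longrightarrow>
        ((\<exists>C\<in>WPQ n q. phi n q C = rat_point n y) \<longleftrightarrow>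
          val_cond n q {..n} y \<and> sign_cond n q {..n} y)) \<and>
     (\<forall>(y :: nat \<Rightarrow> rat) (z :: nat \<Rightarrow> int). (\<forall>i\<le>n. y i \<noteq> 0) \<longrightarrow>
        Gcd (z ` {..n}) = 1 \<longrightarrow> rat_point n (\<lambda>i. of_int (z i)) = rat_point n y \<longrightarrow>
        (val_cond n q {..n} y \<longleftrightarrow>
          (\<forall>p. prime p \<longrightarrow> (\<lambda>i\<in>{..n}. rat_val p (of_int (z i))) \<in> Mq n q))) \<and>
     (\<forall>y :: nat \<Rightarrow> rat. (\<exists>i\<le>n. y i \<noteq> 0) \<longrightarrow>
        ((\<exists>C\<in>WPQ n q. phi n q C = rat_point n y) \<longleftrightarrow>
          val_cond n q {i. i \<le> n \<and> y i \<noteq> 0} y \<and> sign_cond n q {i. i \<le> n \<and> y i \<noteq> 0} y))"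
proof (intro conjI allI impI)
  fix y :: "nat \<Rightarrow> rat" assume y: "\<forall>i\<le>n. y i \<noteq> 0"
  \<comment> \<open>The first claim is the case of the third in which the nonzero coordinates are
    all of them.\<close>
  then have "{i. i \<le> n \<and> y i \<noteq> 0} = {..n}" "\<exists>i\<le>n. y i \<noteq> 0"
    by auto
  then show "(\<exists>C\<in>WPQ n q. phi n q C = rat_point n y) \<longleftrightarrow>
      val_cond n q {..n} y \<and> sign_cond n q {..n} y"
    using preimage_criterion[OF assms, of y] by simp
next
  fix y :: "nat \<Rightarrow> rat" and z :: "nat \<Rightarrow> int"
  assume y: "\<forall>i\<le>n. y i \<noteq> 0" and gcd: "Gcd (z ` {..n}) = 1"
    and eq: "rat_point n (\<lambda>i. of_int (z i)) = rat_point n y"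
  have "\<exists>i\<le>n. y i \<noteq> 0"
    using y by blast
  \<comment> \<open>The rational factor between the two representatives shows that no
    \<open>z i\<close> vanishes and carries condition (i) from \<open>y\<close> to
    \<open>z\<close>.\<close>
  then obtain l where l: "l \<noteq> 0" "\<And>i. i \<le> n \<Longrightarrow> of_int (z i) = l * y i"
    using eq rat_point_eq_iff[of n y "\<lambda>i. of_int (z i)"] by metis
  have z: "z i \<noteq> 0" if "i \<le> n" for i
    using l(2)[OF that] l(1) y that by auto
  have "val_cond n q {..n} y \<longleftrightarrow> val_cond n q {..n} (\<lambda>i. of_int (z i))"
    using l y by (intro val_cond_scale[symmetric]) auto
  also have "\<dots> \<longleftrightarrow> (\<forall>p. prime p \<longrightarrow> (\<lambda>i\<in>{..n}. rat_val p (of_int (z i))) \<in> Mq n q)"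
    using z gcd by (rule val_cond_iff_Mq)
  finally show "val_cond n q {..n} y \<longleftrightarrow>
      (\<forall>p. prime p \<longrightarrow> (\<lambda>i\<in>{..n}. rat_val p (of_int (z i))) \<in> Mq n q)" .
qed (rule preimage_criterion[OF assms])

end
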